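(* Let $m$ be a positive integer. Then for any oriented graph $D$, we have $$\chi_m(D) \leq \left\lfloor \sqrt{\frac{2m}{2m+1}} \cdot \frac{\tilde\Delta(D)}{m} + \frac{2}{4m+1} \right\rfloor + 1.$$
   Context: Digraphs are finite, nonempty, without loops and without parallel edges in the same direction. An oriented graph is a digraph in which at most one edge connects any pair of vertices (so there are no directed 2-cycles). For a vertex $v$, $d^+(v)$ and $d^-(v)$ are its out-degree and in-degree. $\tilde{\Delta}(D) = \max_{v \in V(D)} \sqrt{d^+(v)\,d^-(v)}$ is the maximum geometric mean of the in-degree and out-degree of a vertex. For a positive integer $m$, a digraph is weakly $m$-degenerate if every (nonempty) induced subgraph of it has a vertex whose in-degree or out-degree in that subgraph is strictly less than $m$. $\chi_m(D)$, the $m$-degenerate chromatic number, is the smallest positive integer $k$ such that $V(D)$ can be partitioned into $k$ sets, each of which induces a weakly $m$-degenerate subgraph. *)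

theory Defs
  imports Complex_Main "HOL-Library.Disjoint_Sets" "Graph_Theory.Digraph_Component"
begin

text \<open>
  The library locale \<^locale>\<open>digraph\<close> gives finiteness and excludes loops and parallel arcs,
  but it admits the graph without vertices, so nonemptiness is added here.
\<close>
locale oriented_graph = digraph +
  assumes verts_nonempty: "verts G \<noteq> {}"
    and at_most_one_arc: "\<lbrakk>e1 \<in> arcs G; e2 \<in> arcs G;
      {tail G e1, head G e1} = {tail G e2, head G e2}\<rbrakk> \<Longrightarrow> e1 = e2"

definition max_geo_degree :: "('a, 'b) pre_digraph \<Rightarrow> real" where
  "max_geo_degree D =
     Max ((\<lambda>v. sqrt (real (out_degree D v) * real (in_degree D v))) ` verts D)"

definition weakly_degenerate :: "nat \<Rightarrow> ('a, 'b) pre_digraph \<Rightarrow> bool" where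
  "weakly_degenerate m D \<longleftrightarrow>
     (\<forall>H. induced_subgraph H D \<and> verts H \<noteq> {} \<longrightarrow>
        (\<exists>v\<in>verts H. in_degree H v < m \<or> out_degree H v < m))"

definition degenerate_partition ::
    "nat \<Rightarrow> ('a, 'b) pre_digraph \<Rightarrow> 'a set set \<Rightarrow> bool" where
  "degenerate_partition m D P \<longleftrightarrow>
     partition_on (verts D) P \<and> (\<forall>S\<in>P. weakly_degenerate m (D \<restriction> S))"

definition degenerate_chromatic_number :: "nat \<Rightarrow> ('a, 'b) pre_digraph \<Rightarrow> nat" where
  "degenerate_chromatic_number m D =
     (LEAST k. 0 < k \<and> (\<exists>P. degenerate_partition m D P \<and> card P = k))"

text \<open>The minimum in the last definition is attained: the singletons form a valid partition.\<close>

lemma (in oriented_graph) degenerate_chromatic_number_attained: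
  assumes "0 < m"
  shows "0 < degenerate_chromatic_number m G \<and>
    (\<exists>P. degenerate_partition m G P \<and> card P = degenerate_chromatic_number m G)"
proof -
  let ?P = "(\<lambda>v. {v}) ` verts G"
  have "weakly_degenerate m (G \<restriction> {v})" for v
    unfolding weakly_degenerate_def
  proof (intro allI impI, elim conjE)
    fix H assume H: "induced_subgraph H (G \<restriction> {v})" and "verts H \<noteq> {}"
    then obtain u where u: "u \<in> verts H" by blast
    have "arcs H \<subseteq> arcs (G \<restriction> {v})"
      using H by (auto simp: induced_subgraph_def)
    also have "\<dots> = {}"
      by (auto simp: induce_subgraph_def dest: no_loops)
    finally have "in_degree H u = 0"
      by (simp add: in_degree_def in_arcs_def)
    with u assms show "\<exists>u\<in>verts H. in_degree H u < m \<or> out_degree H u < m"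
      by (intro bexI[of _ u]) auto
  qed
  then have "degenerate_partition m G ?P"
    by (auto simp: degenerate_partition_def partition_on_def disjoint_def)
  moreover have "0 < card ?P"
    using verts_nonempty by (simp add: card_gt_0_iff)
  ultimately show ?thesis
    unfolding degenerate_chromatic_number_def
    by (intro LeastI[where P = "\<lambda>k. 0 < k \<and> (\<exists>P. degenerate_partition m G P \<and> card P = k)"]) blast
qed

end

theory Submission
  imports Defs
begin

text \<open>
  Let \<open>k\<close> be the claimed number of colours and suppose that the vertices cannot be split into \<open>k\<close>
  classes that induce weakly \<open>m\<close>-degenerate subgraphs. In a minimal uncolourable vertex set every
  vertex \<open>v\<close> has at least \<open>m\<close> in-neighbours and at least \<open>m\<close> out-neighbours in each class of each
  \<open>k\<close>-colouring of the other vertices, as otherwise \<open>v\<close> could join that class. So the in-degree and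
  the out-degree of \<open>v\<close> are both at least \<open>k m\<close> (\<open>critical_degrees\<close>). As their product is at
  most \<open>\<Delta>\<^sup>2\<close>, where \<open>\<Delta>\<close> is the largest geometric mean of the two degrees of a vertex,
  their sum \<open>d\<close> cannot be large: \<open>2 (d + 1) \<le> k (4 m + 1)\<close> (\<open>degree_sum_bound\<close>).

  It remains to colour with \<open>k\<close> colours under this bound on the total degree
  (\<open>colorable_if_degree_le\<close>). As in Lovasz's decomposition theorem, the vertices split into one set
  of maximum total degree \<open>4 m\<close> and a rest whose maximum total degree is smaller by \<open>4 m + 1\<close>
  (\<open>exists_split_degree_le\<close>). The first set gets two colours, and the rest is coloured by induction
  with \<open>k - 2\<close> colours. A set of total degree below \<open>2 m\<close>, which may remain when \<open>k\<close> is odd, is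
  weakly \<open>m\<close>-degenerate.

  The heart is that two colours suffice for total degree \<open>4 m\<close> (\<open>colorable_two_if_degree_le\<close>). In
  a minimal counterexample, colour all vertices but one with two classes and put the last vertex into
  a class \<open>S\<close>. The vertices of \<open>S\<close> whose deletion repairs the class then form a nonempty set \<open>A\<close>, a
  union of connected components of \<open>S\<close>, in which all in-degrees and out-degrees are exactly \<open>m\<close>.
  Moving any \<open>x \<in> A\<close> to the other class \<open>T\<close> creates the same situation there. Repeat this, each
  time moving a vertex other than the one that has just arrived. Because the graph is oriented, a
  vertex of \<open>T\<close> can never complete the remainder \<open>A - {x}\<close>, or a part of it, to another obstruction
  (\<open>proper_subset_unabsorbable\<close>). So \<open>A - {x}\<close> is frozen for ever, and every move freezes new
  vertices, which is impossible in a finite graph.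
\<close>

section \<open>Degenerate sets and colourings of a relation\<close>

definition ind :: "('a \<Rightarrow> 'a \<Rightarrow> bool) \<Rightarrow> 'a set \<Rightarrow> 'a \<Rightarrow> nat" where
  "ind E S v = card {u \<in> S. E u v}"

definition outd :: "('a \<Rightarrow> 'a \<Rightarrow> bool) \<Rightarrow> 'a set \<Rightarrow> 'a \<Rightarrow> nat" where
  "outd E S v = card {u \<in> S. E v u}"

definition dense :: "nat \<Rightarrow> ('a \<Rightarrow> 'a \<Rightarrow> bool) \<Rightarrow> 'a set \<Rightarrow> bool" where
  "dense m E A \<longleftrightarrow> (\<forall>v\<in>A. m \<le> ind E A v \<and> m \<le> outd E A v)"

text \<open>
  The vertex set \<open>S\<close> induces a weakly \<open>m\<close>-degenerate subgraph of the digraph with arc relation \<open>E\<close>;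
  a nonempty dense subset is exactly a violating induced subgraph.
\<close>
definition degenerate :: "nat \<Rightarrow> ('a \<Rightarrow> 'a \<Rightarrow> bool) \<Rightarrow> 'a set \<Rightarrow> bool" where
  "degenerate m E S \<longleftrightarrow> (\<forall>A\<subseteq>S. dense m E A \<longrightarrow> A = {})"

text \<open>
  Colour classes may be empty, so that colourings of two sets can be combined without counting the
  colours in use.
\<close>
definition colorable :: "nat \<Rightarrow> ('a \<Rightarrow> 'a \<Rightarrow> bool) \<Rightarrow> nat \<Rightarrow> 'a set \<Rightarrow> bool" where
  "colorable m E k V \<longleftrightarrow>
     (\<exists>f :: 'a \<Rightarrow> nat. (\<forall>v\<in>V. f v < k) \<and> (\<forall>i<k. degenerate m E {v \<in> V. f v = i}))"

lemma ind_mono: "finite T \<Longrightarrow> S \<subseteq> T \<Longrightarrow> ind E S v \<le> ind E T v"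
  unfolding ind_def by (rule card_mono) auto

lemma outd_mono: "finite T \<Longrightarrow> S \<subseteq> T \<Longrightarrow> outd E S v \<le> outd E T v"
  unfolding outd_def by (rule card_mono) auto

lemma ind_Un_disjoint:
  "finite S \<Longrightarrow> finite T \<Longrightarrow> S \<inter> T = {} \<Longrightarrow> ind E (S \<union> T) v = ind E S v + ind E T v"
  unfolding ind_def by (subst card_Un_disjoint[symmetric]) (auto intro: arg_cong[of _ _ card])

lemma outd_Un_disjoint:
  "finite S \<Longrightarrow> finite T \<Longrightarrow> S \<inter> T = {} \<Longrightarrow> outd E (S \<union> T) v = outd E S v + outd E T v"
  unfolding outd_def by (subst card_Un_disjoint[symmetric]) (auto intro: arg_cong[of _ _ card])

lemma ind_insert:
  "finite S \<Longrightarrow> w \<notin> S \<Longrightarrow> ind E (insert w S) v = ind E S v + (if E w v then 1 else 0)"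
  using ind_Un_disjoint[of "{w}" S E v] by (auto simp: ind_def Collect_conv_if cong: conj_cong)

lemma outd_insert:
  "finite S \<Longrightarrow> w \<notin> S \<Longrightarrow> outd E (insert w S) v = outd E S v + (if E v w then 1 else 0)"
  using outd_Un_disjoint[of "{w}" S E v] by (auto simp: outd_def Collect_conv_if cong: conj_cong)

lemma ind_eq_imp_subset:
  assumes "finite T" "S \<subseteq> T" "ind E T v \<le> ind E S v" "u \<in> T" "E u v"
  shows "u \<in> S"
proof -
  have "{u \<in> S. E u v} = {u \<in> T. E u v}"
    using assms(1-3) unfolding ind_def by (intro card_seteq) auto
  then show ?thesis using assms(4,5) by blast
qed

lemma outd_eq_imp_subset:
  assumes "finite T" "S \<subseteq> T" "outd E T v \<le> outd E S v" "u \<in> T" "E v u"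
  shows "u \<in> S"
proof -
  have "{u \<in> S. E v u} = {u \<in> T. E v u}"
    using assms(1-3) unfolding outd_def by (intro card_seteq) auto
  then show ?thesis using assms(4,5) by blast
qed

lemma sum_ind_eq_sum_outd:
  assumes "finite A"
  shows "(\<Sum>v\<in>A. ind E A v) = (\<Sum>v\<in>A. outd E A v)"
  unfolding ind_def outd_def by (rule sum_multicount_gen) (use assms in auto)

lemma degenerate_subset: "degenerate m E S \<Longrightarrow> T \<subseteq> S \<Longrightarrow> degenerate m E T"
  unfolding degenerate_def by blast

lemma colorable_two:
  "colorable m E 2 V \<longleftrightarrow>
     (\<exists>S T. S \<union> T = V \<and> S \<inter> T = {} \<and> degenerate m E S \<and> degenerate m E T)"
proof
  assume "colorable m E 2 V"
  then obtain f :: "'a \<Rightarrow> nat" where f: "\<forall>v\<in>V. f v < 2"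
    "\<forall>i<2. degenerate m E {v \<in> V. f v = i}"
    unfolding colorable_def by blast
  have "{v \<in> V. f v = 0} \<union> {v \<in> V. f v = 1} = V" using f(1) by (auto simp: less_2_cases_iff)
  moreover have "{v \<in> V. f v = 0} \<inter> {v \<in> V. f v = 1} = {}" by auto
  ultimately show "\<exists>S T. S \<union> T = V \<and> S \<inter> T = {} \<and> degenerate m E S \<and> degenerate m E T"
    using f(2) by (metis one_less_numeral_iff semiring_norm(76) zero_less_numeral)
next
  assume "\<exists>S T. S \<union> T = V \<and> S \<inter> T = {} \<and> degenerate m E S \<and> degenerate m E T"
  then obtain S T where ST: "S \<union> T = V" "S \<inter> T = {}" "degenerate m E S" "degenerate m E T"
    by blast
  define f :: "'a \<Rightarrow> nat" where "f v = (if v \<in> S then 0 else 1)" for v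
  have "{v \<in> V. f v = 0} = S" "{v \<in> V. f v = 1} = T" using ST by (auto simp: f_def)
  then show "colorable m E 2 V"
    unfolding colorable_def using ST
    by (intro exI[of _ f]) (auto simp: f_def less_2_cases_iff)
qed

lemma colorable_Un:
  assumes "colorable m E k V" "colorable m E l W"
  shows "colorable m E (k + l) (V \<union> W)"
proof -
  obtain f g where f: "\<forall>v\<in>V. f v < k" "\<forall>i<k. degenerate m E {v \<in> V. f v = i}"
    and g: "\<forall>v\<in>W. g v < l" "\<forall>i<l. degenerate m E {v \<in> W. g v = i}"
    using assms unfolding colorable_def by blast
  define h where "h v = (if v \<in> V then f v else k + g v)" for v
  have "degenerate m E {v \<in> V \<union> W. h v = i}" if "i < k + l" for i
  proof (cases "i < k")
    case True
    then have "{v \<in> V \<union> W. h v = i} \<subseteq> {v \<in> V. f v = i}" by (auto simp: h_def)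
    with f(2) True show ?thesis by (blast intro: degenerate_subset)
  next
    case False
    then have "{v \<in> V \<union> W. h v = i} \<subseteq> {v \<in> W. g v = i - k}"
      using f(1) by (auto simp: h_def)
    moreover have "i - k < l" using False that by simp
    ultimately show ?thesis using g(2) by (blast intro: degenerate_subset)
  qed
  then show ?thesis unfolding colorable_def using f(1) g(1)
    by (intro exI[of _ h]) (auto simp: h_def trans_less_add1)
qed

text \<open>
  A violating subset of \<open>insert v S\<close> must contain \<open>v\<close>, and then \<open>v\<close> itself has too small a degree.
\<close>
lemma degenerate_insert:
  assumes "finite S" "degenerate m E S" "\<not> E v v" "ind E S v < m \<or> outd E S v < m"
  shows "degenerate m E (insert v S)"
  unfolding degenerate_def
proof (intro allI impI)
  fix A assume A: "A \<subseteq> insert v S" "dense m E A"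
  show "A = {}"
  proof (cases "v \<in> A")
    case True
    have "{u \<in> A. E u v} \<subseteq> {u \<in> S. E u v}" "{u \<in> A. E v u} \<subseteq> {u \<in> S. E v u}"
      using A(1) assms(3) by auto
    then have "ind E A v \<le> ind E S v" "outd E A v \<le> outd E S v"
      unfolding ind_def outd_def using assms(1) by (simp_all add: card_mono)
    then show ?thesis using A(2) True assms(4) unfolding dense_def by fastforce
  next
    case False
    then have "A \<subseteq> S" using A(1) by blast
    then show ?thesis using A(2) assms(2) unfolding degenerate_def by blast
  qed
qed

lemma degenerate_if_degree_small:
  assumes "finite S" "\<And>v. v \<in> S \<Longrightarrow> ind E S v + outd E S v < 2 * m"
  shows "degenerate m E S"
  unfolding degenerate_def
proof (intro allI impI, rule ccontr)
  fix A assume A: "A \<subseteq> S" "dense m E A" "A \<noteq> {}"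
  then obtain v where v: "v \<in> A" by blast
  have "ind E A v \<le> ind E S v" "outd E A v \<le> outd E S v"
    using A(1) assms(1) by (simp_all add: ind_mono outd_mono)
  moreover have "m \<le> ind E A v" "m \<le> outd E A v" using A(2) v unfolding dense_def by auto
  ultimately show False using assms(2)[of v] v A(1) by auto
qed

section \<open>Splitting by degrees\<close>

text \<open>
  Choose the split \<open>V = X \<union> Y\<close> that minimises the number of arcs inside the parts plus
  \<open>b |X| + a |Y|\<close>. A vertex of \<open>X\<close> with more than \<open>a\<close> neighbours in \<open>X\<close> has at most \<open>b\<close> neighbours
  in \<open>Y\<close>, so moving it to \<open>Y\<close> loses at least \<open>a + 1\<close> arcs, gains at most \<open>b\<close>, and changes the
  weights by \<open>a - b\<close>: the potential drops.
\<close>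
lemma exists_split_degree_le:
  assumes "finite V" and noloop: "\<And>v. \<not> E v v"
    and deg: "\<And>v. v \<in> V \<Longrightarrow> ind E V v + outd E V v \<le> a + b + 1"
  shows "\<exists>X Y. X \<union> Y = V \<and> X \<inter> Y = {} \<and>
    (\<forall>v\<in>X. ind E X v + outd E X v \<le> a) \<and> (\<forall>v\<in>Y. ind E Y v + outd E Y v \<le> b)"
proof -
  define e where "e S = (\<Sum>u\<in>S. outd E S u)" for S
  (* e counts the arcs inside a set. *)
  have e_insert: "e (insert v S) = e S + (ind E S v + outd E S v)"
    if "finite S" "v \<notin> S" for S v
  proof -
    have "(\<Sum>u\<in>S. outd E (insert v S) u) = (\<Sum>u\<in>S. outd E S u) + (\<Sum>u\<in>S. if E u v then 1 else 0)"
      using that by (simp add: outd_insert sum.distrib)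
    also have "(\<Sum>u\<in>S. if E u v then 1 else 0) = ind E S v"
      using that(1) by (simp add: ind_def sum.If_cases Int_def)
    finally show ?thesis
      using that noloop by (simp add: e_def outd_insert)
  qed
  define potential where
    "potential a b X Y = e X + e Y + b * card X + a * card Y" for a b :: nat and X Y
  have improve: "potential a b (X - {v}) (insert v Y) < potential a b X Y"
    if XY: "X \<union> Y = V" "X \<inter> Y = {}" and v: "v \<in> X" "a < ind E X v + outd E X v"
      and deg: "ind E V v + outd E V v \<le> a + b + 1" for a b X Y v
  proof -
    have fin: "finite X" "finite Y" using XY(1) \<open>finite V\<close> by auto
    have "v \<notin> Y" using v XY by auto
    have X: "insert v (X - {v}) = X" using v by auto
    have "ind E (X - {v}) v = ind E X v" "outd E (X - {v}) v = outd E X v"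
      using ind_insert[of "X - {v}" v E v] outd_insert[of "X - {v}" v E v] X fin noloop by auto
    then have eX: "e X = e (X - {v}) + (ind E X v + outd E X v)"
      using e_insert[of "X - {v}" v] X fin by simp
    have "ind E Y v + outd E Y v \<le> b"
      using deg v ind_Un_disjoint[OF fin XY(2), of E v] outd_Un_disjoint[OF fin XY(2), of E v] XY(1)
      by simp
    moreover have "card X = Suc (card (X - {v}))" using v fin by (metis card_Suc_Diff1)
    ultimately show ?thesis
      using eX e_insert[OF fin(2) \<open>v \<notin> Y\<close>] \<open>v \<notin> Y\<close> fin v(2)
      by (simp add: potential_def)
  qed
  (* The potential is invariant under exchanging the two parts together with a and b, so the same
     improvement step serves for moves in both directions. *)
  obtain X where X: "X \<subseteq> V"
    and least: "\<And>X'. X' \<subseteq> V \<Longrightarrow> potential a b X (V - X) \<le> potential a b X' (V - X')"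
    using ex_has_least_nat[of "\<lambda>X. X \<subseteq> V" V "\<lambda>X. potential a b X (V - X)"] by auto
  have sym: "potential b a Y X = potential a b X Y" for X Y
    by (simp add: potential_def)
  have "ind E X v + outd E X v \<le> a" if "v \<in> X" for v
  proof (rule ccontr)
    assume "\<not> ?thesis"
    then have "potential a b (X - {v}) (insert v (V - X)) < potential a b X (V - X)"
      using that X deg by (intro improve) auto
    moreover have "insert v (V - X) = V - (X - {v})" using that X by auto
    ultimately show False using least[of "X - {v}"] X by auto
  qed
  moreover have "ind E (V - X) v + outd E (V - X) v \<le> b" if "v \<in> V - X" for v
  proof (rule ccontr)
    assume "\<not> ?thesis"
    then have "potential b a (V - X - {v}) (insert v X) < potential b a (V - X) X"
      using that X deg[of v] by (intro improve) auto
    moreover have "V - X - {v} = V - insert v X" by auto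
    ultimately show False using least[of "insert v X"] X that by (auto simp: sym)
  qed
  ultimately show ?thesis using X
    by (intro exI[of _ X] exI[of _ "V - X"]) auto
qed

section \<open>Two colours\<close>

definition removable :: "nat \<Rightarrow> ('a \<Rightarrow> 'a \<Rightarrow> bool) \<Rightarrow> 'a set \<Rightarrow> 'a set" where
  "removable m E S = {c \<in> S. degenerate m E (S - {c})}"

text \<open>
  The vertex \<open>w\<close> cannot absorb any part of \<open>F\<close> into a dense set whose trace on \<open>F\<close> is \<open>A\<close>, as long
  as the vertices of \<open>A\<close> have no further neighbours in that dense set. The degree of \<open>w\<close> itself is
  left open, so that the property passes to unions of sets without arcs between them.
\<close>
definition unabsorbable :: "nat \<Rightarrow> ('a \<Rightarrow> 'a \<Rightarrow> bool) \<Rightarrow> 'a set \<Rightarrow> 'a \<Rightarrow> bool" where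
  "unabsorbable m E F w \<longleftrightarrow>
     (\<forall>A\<subseteq>F. A \<noteq> {} \<longrightarrow> (\<exists>q\<in>A. ind E (insert w A) q < m \<or> outd E (insert w A) q < m))"

locale two_color_obstruction =
  fixes E :: "'a \<Rightarrow> 'a \<Rightarrow> bool" and m :: nat and V :: "'a set"
  assumes asym: "E u v \<Longrightarrow> \<not> E v u"
    and pos: "0 < m"
    and fin: "finite V"
    and deg: "v \<in> V \<Longrightarrow> ind E V v + outd E V v \<le> 4 * m"
    and not_colorable: "\<not> colorable m E 2 V"
begin

lemma no_loop: "\<not> E v v"
  using asym by blast

text \<open>
  Neither class can take \<open>v\<close>, so \<open>v\<close> has at least \<open>m\<close> in-neighbours and \<open>m\<close> out-neighbours in
  both; the total of at most \<open>4 m\<close> leaves no slack. By symmetry in \<open>S\<close> and \<open>T\<close> the same holds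
  for \<open>T\<close>.
\<close>
lemma token_degrees:
  assumes S: "degenerate m E S" and T: "degenerate m E T"
    and v: "v \<in> V" and ST: "S \<union> T = V - {v}" "S \<inter> T = {}"
  shows "ind E S v = m" "outd E S v = m"
proof -
  have fin': "finite S" "finite T" using fin ST(1) by (metis finite_Diff finite_Un)+
  have S': "\<not> degenerate m E (insert v S)"
  proof
    assume "degenerate m E (insert v S)"
    moreover have "insert v S \<union> T = V" "insert v S \<inter> T = {}" using ST v by auto
    ultimately show False using not_colorable T unfolding colorable_two by blast
  qed
  have T': "\<not> degenerate m E (insert v T)"
  proof
    assume "degenerate m E (insert v T)"
    moreover have "S \<union> insert v T = V" "S \<inter> insert v T = {}" using ST v by auto
    ultimately show False using not_colorable S unfolding colorable_two by blast
  qed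
  have "m \<le> ind E S v" "m \<le> outd E S v" "m \<le> ind E T v" "m \<le> outd E T v"
    using S' T' S T fin' no_loop by (meson degenerate_insert not_le)+
  moreover have "ind E S v + ind E T v \<le> ind E V v" "outd E S v + outd E T v \<le> outd E V v"
    using ind_Un_disjoint[OF fin' ST(2), of E v] outd_Un_disjoint[OF fin' ST(2), of E v]
      ind_mono[OF fin, of "V - {v}" E v] outd_mono[OF fin, of "V - {v}" E v] ST(1)
    by auto
  ultimately show "ind E S v = m" "outd E S v = m" using deg[OF v] by linarith+
qed

context
  fixes S T :: "'a set"
  assumes ST: "S \<union> T = V" "S \<inter> T = {}" and T: "degenerate m E T"
begin

lemma finite_parts: "finite S" "finite T"
  using fin ST(1) by auto

lemma removable_degrees:
  assumes "c \<in> removable m E S"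
  shows "ind E S c = m" "outd E S c = m"
proof -
  have c: "c \<in> S" "degenerate m E (S - {c})" using assms by (auto simp: removable_def)
  have "insert c (S - {c}) = S" using c by auto
  then have "ind E S c = ind E (S - {c}) c" "outd E S c = outd E (S - {c}) c"
    using ind_insert[of "S - {c}" c E c] outd_insert[of "S - {c}" c E c] finite_parts no_loop by auto
  moreover have "S - {c} \<union> T = V - {c}" "(S - {c}) \<inter> T = {}" using ST c by auto
  ultimately show "ind E S c = m" "outd E S c = m"
    using token_degrees[OF c(2) T, of c] c ST by auto
qed

text \<open>
  A violating subset of \<open>S - {u}\<close> would contain \<open>c\<close>, since deleting \<open>c\<close> repairs \<open>S\<close>. But \<open>c\<close> has
  only \<open>m\<close> in-neighbours and \<open>m\<close> out-neighbours in \<open>S\<close>, so the subset needs all of them,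
  including \<open>u\<close>.
\<close>
lemma removable_neighbour:
  assumes c: "c \<in> removable m E S" and u: "u \<in> S" "E c u \<or> E u c"
  shows "u \<in> removable m E S"
proof -
  have "A = {}" if A: "A \<subseteq> S - {u}" "dense m E A" for A
  proof (rule ccontr)
    assume "A \<noteq> {}"
    have "c \<in> A"
    proof (rule ccontr)
      assume "c \<notin> A"
      then have "A \<subseteq> S - {c}" using A by auto
      then show False using c A(2) \<open>A \<noteq> {}\<close> by (auto simp: removable_def degenerate_def)
    qed
    then have "ind E S c \<le> ind E A c" "outd E S c \<le> outd E A c"
      using A(2) removable_degrees[OF c] by (auto simp: dense_def)
    then have "u \<in> A"
      using u A(1) finite_parts ind_eq_imp_subset[of S A E c u] outd_eq_imp_subset[of S A E c u]
      by blast
    then show False using A(1) by auto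
  qed
  then show ?thesis using u(1) by (auto simp: removable_def degenerate_def)
qed

lemma removable_regular:
  assumes c: "c \<in> removable m E S"
  shows "ind E (removable m E S) c = m" "outd E (removable m E S) c = m"
proof -
  have "{u \<in> removable m E S. E u c} = {u \<in> S. E u c}"
       "{u \<in> removable m E S. E c u} = {u \<in> S. E c u}"
    using removable_neighbour[OF c] by (auto simp: removable_def)
  then show "ind E (removable m E S) c = m" "outd E (removable m E S) c = m"
    using removable_degrees[OF c] by (simp_all add: ind_def outd_def)
qed

end

text \<open>
  First \<open>q\<close> goes to \<open>T\<close>; its neighbour \<open>w\<close> is then removable from \<open>insert q T\<close>, which makes \<open>w\<close> a
  vertex left over by the colouring with classes \<open>S - {q}\<close> and \<open>insert q T - {w}\<close>.
\<close>
lemma degrees_after_exchange: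
  assumes ST: "S \<union> T = V" "S \<inter> T = {}" and T: "degenerate m E T"
    and q: "q \<in> removable m E S" and w: "w \<in> T" "E q w \<or> E w q"
  shows "ind E (S - {q}) w = m" "outd E (S - {q}) w = m"
proof -
  have qS: "q \<in> S" "q \<notin> T" "degenerate m E (S - {q})" using q ST(2) by (auto simp: removable_def)
  have part: "insert q T \<union> (S - {q}) = V" "insert q T \<inter> (S - {q}) = {}" using qS ST by auto
  have "insert q T - {q} = T" using qS by auto
  then have "q \<in> removable m E (insert q T)" using T by (auto simp: removable_def)
  then have "w \<in> removable m E (insert q T)"
    using removable_neighbour[OF part qS(3), of q w] w by auto
  then have "degenerate m E (insert q T - {w})" by (auto simp: removable_def)
  moreover have "S - {q} \<union> (insert q T - {w}) = V - {w}" "(S - {q}) \<inter> (insert q T - {w}) = {}"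
    "w \<in> V"
    using qS ST w by auto
  ultimately show "ind E (S - {q}) w = m" "outd E (S - {q}) w = m"
    using token_degrees[OF qS(3)] by blast+
qed

text \<open>
  This is where the absence of directed 2-cycles enters. Suppose that \<open>w\<close> makes up for all degrees
  missing in \<open>A\<close>. If \<open>w\<close> had both an out-neighbour \<open>p\<close> and an in-neighbour \<open>q\<close> in \<open>A\<close>, then
  \<open>degrees_after_exchange\<close> for \<open>p\<close> and for \<open>q\<close> would give \<open>w\<close> both \<open>m + 1\<close> and \<open>m\<close>
  out-neighbours in \<open>S\<close>. So all arcs between \<open>w\<close> and \<open>A\<close> point the same way, and either all
  out-degrees or all in-degrees within \<open>A\<close> are \<open>m\<close> without the help of \<open>w\<close>. The sums of both kinds
  of degrees agree and no degree exceeds \<open>m\<close>, so all degrees within \<open>A\<close> are \<open>m\<close>. But then \<open>A\<close> is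
  dense, although it avoids some removable vertex.
\<close>
lemma proper_subset_unabsorbable:
  assumes ST: "S \<union> T = V" "S \<inter> T = {}" and T: "degenerate m E T"
    and w: "w \<in> T" and A: "A \<subset> removable m E S" "A \<noteq> {}"
  shows "\<exists>q\<in>A. ind E (insert w A) q < m \<or> outd E (insert w A) q < m"
proof (rule ccontr)
  assume "\<not> ?thesis"
  then have large: "m \<le> ind E (insert w A) q" "m \<le> outd E (insert w A) q" if "q \<in> A" for q
    using that by (auto simp: not_less)
  have finite_parts: "finite S" "finite T" using fin ST(1) by auto
  have AS: "A \<subseteq> S" using A(1) by (auto simp: removable_def)
  have "w \<notin> A" using AS w ST by auto
  have finA: "finite A" using AS finite_parts finite_subset by blast
  obtain y where y: "y \<in> removable m E S" "y \<notin> A" using A(1) by blast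
  have not_dense: "\<not> dense m E A"
    using y A(2) AS by (auto simp: removable_def degenerate_def)
  have le: "ind E A q \<le> m" "outd E A q \<le> m" if "q \<in> A" for q
    using removable_degrees[OF ST T, of q] ind_mono[OF finite_parts(1) AS, of E q]
      outd_mono[OF finite_parts(1) AS, of E q] that A(1) by auto
  consider (in_out) p q where "p \<in> A" "q \<in> A" "E w p" "E q w"
    | (no_in) "\<And>q. q \<in> A \<Longrightarrow> \<not> E q w" | (no_out) "\<And>q. q \<in> A \<Longrightarrow> \<not> E w q"
    by blast
  then show False
  proof cases
    case in_out
    have p: "p \<in> removable m E S" and q: "q \<in> removable m E S" using in_out A(1) by auto
    have "insert p (S - {p}) = S" "insert q (S - {q}) = S" using p q by (auto simp: removable_def)
    then have "outd E S w = outd E (S - {p}) w + 1" "outd E S w = outd E (S - {q}) w"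
      using outd_insert[of "S - {p}" p E w] outd_insert[of "S - {q}" q E w] finite_parts
        in_out(3,4) asym by auto
    then show False
      using degrees_after_exchange(2)[OF ST T p w] degrees_after_exchange(2)[OF ST T q w] in_out by auto
  next
    case no_in
    then have out: "outd E A q = m" if "q \<in> A" for q
      using that large(2)[OF that] le(2)[OF that] outd_insert[OF finA \<open>w \<notin> A\<close>, of E q] by auto
    then have "(\<Sum>v\<in>A. ind E A v) = (\<Sum>v\<in>A. m)"
      using sum_ind_eq_sum_outd[OF finA, of E] by simp
    then have "ind E A q = m" if "q \<in> A" for q
      using sum_mono_inv[of "\<lambda>v. ind E A v" A "\<lambda>_. m" q] le(1) finA that by auto
    then show False using not_dense out by (simp add: dense_def)
  next
    case no_out
    then have "in": "ind E A q = m" if "q \<in> A" for q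
      using that large(1)[OF that] le(1)[OF that] ind_insert[OF finA \<open>w \<notin> A\<close>, of E q] by auto
    then have "(\<Sum>v\<in>A. outd E A v) = (\<Sum>v\<in>A. m)"
      using sum_ind_eq_sum_outd[OF finA, of E] by simp
    then have "outd E A q = m" if "q \<in> A" for q
      using sum_mono_inv[of "\<lambda>v. outd E A v" A "\<lambda>_. m" q] le(2) finA that by auto
    then show False using not_dense "in" by (simp add: dense_def)
  qed
qed

text \<open>
  The invariant of the moving process: \<open>S\<close> is the class that is obstructed at present, \<open>x\<close> the
  vertex that has just arrived in it, and \<open>F\<close> and \<open>G\<close> are the frozen parts of the two classes. Only
  \<open>x\<close> is exempt from the last condition: after a move it has just left a dense set whose remainder lies in
  \<open>G\<close>, so it could complete that set again.
\<close>
definition frozen_state :: "'a set \<Rightarrow> 'a set \<Rightarrow> 'a set \<Rightarrow> 'a set \<Rightarrow> 'a \<Rightarrow> bool" where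
  "frozen_state S T F G x \<longleftrightarrow>
     S \<union> T = V \<and> S \<inter> T = {} \<and> degenerate m E T \<and> x \<in> removable m E S \<and>
     F \<subseteq> S \<and> G \<subseteq> T \<and> removable m E S \<inter> F = {} \<and>
     (\<forall>u\<in>F. \<forall>v\<in>S - F. \<not> E u v \<and> \<not> E v u) \<and>
     (\<forall>u\<in>G. \<forall>v\<in>T - G. \<not> E u v \<and> \<not> E v u) \<and>
     (\<forall>w\<in>T - G. unabsorbable m E F w) \<and>
     (\<forall>w\<in>S - F - {x}. unabsorbable m E G w)"

text \<open>
  Move some \<open>x' \<noteq> x\<close> of the removable set \<open>A\<close> to \<open>T\<close> and freeze \<open>A - {x'}\<close>, which contains \<open>x\<close>.
  The new removable set \<open>R\<close> avoids \<open>G\<close>, because a nonempty intersection with \<open>G\<close> would be absorbed by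
  \<open>x'\<close>; so \<open>x'\<close> has no neighbour in \<open>G\<close>, and the two classes have swapped their roles.
\<close>
lemma frozen_state_step:
  assumes "frozen_state S T F G x"
  shows "\<exists>S' T' F' G' x'. frozen_state S' T' F' G' x' \<and> card (F \<union> G) < card (F' \<union> G')"
proof -
  have ST: "S \<union> T = V" "S \<inter> T = {}" and T: "degenerate m E T" and x: "x \<in> removable m E S"
    and F: "F \<subseteq> S" and G: "G \<subseteq> T" and disj: "removable m E S \<inter> F = {}"
    and F_sep: "\<And>u v. u \<in> F \<Longrightarrow> v \<in> S - F \<Longrightarrow> \<not> E u v \<and> \<not> E v u"
    and G_sep: "\<And>u v. u \<in> G \<Longrightarrow> v \<in> T - G \<Longrightarrow> \<not> E u v \<and> \<not> E v u"
    and F_un: "\<And>w. w \<in> T - G \<Longrightarrow> unabsorbable m E F w"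
    and G_un: "\<And>w. w \<in> S - F - {x} \<Longrightarrow> unabsorbable m E G w"
    using assms unfolding frozen_state_def by auto
  define A where "A = removable m E S"
  have AS: "A \<subseteq> S" by (auto simp: A_def removable_def)
  have "finite S" "finite T" using ST(1) fin by auto
  have "ind E A x = m" using removable_regular[OF ST T x] by (simp add: A_def)
  then have "{u \<in> A. E u x} \<noteq> {}" using pos unfolding ind_def by (metis card.empty less_irrefl)
  then obtain x' where x': "x' \<in> A" "x' \<noteq> x" using no_loop by blast
  define R where "R = removable m E (insert x' T)"
  have x'S: "x' \<in> S" "x' \<notin> T" "x' \<notin> F" using x' AS ST(2) disj by (auto simp: A_def)
  have part: "insert x' T \<union> (S - {x'}) = V" "insert x' T \<inter> (S - {x'}) = {}"
    using x'S ST by auto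
  have S_good: "degenerate m E (S - {x'})" using x' by (auto simp: A_def removable_def)
  have "insert x' T - {x'} = T" using x'S by auto
  then have x'R: "x' \<in> R" using T by (auto simp: R_def removable_def)
  have A_sep: "\<not> E u v \<and> \<not> E v u" if "u \<in> A" "v \<in> S - A" for u v
    using removable_neighbour[OF ST T, of u v] that by (auto simp: A_def)
  have R_G: "R \<inter> G = {}"
  proof (rule ccontr)
    assume ne: "R \<inter> G \<noteq> {}"
    have "unabsorbable m E G x'" using G_un x'S x' by auto
    then obtain q where q: "q \<in> R \<inter> G"
      "ind E (insert x' (R \<inter> G)) q < m \<or> outd E (insert x' (R \<inter> G)) q < m"
      unfolding unabsorbable_def using ne by (meson Int_lower2)
    have "R \<subseteq> insert x' T" by (auto simp: R_def removable_def)
    then have "{u \<in> insert x' (R \<inter> G). E u q} = {u \<in> R. E u q}"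
      "{u \<in> insert x' (R \<inter> G). E q u} = {u \<in> R. E q u}"
      using G_sep q(1) x'R by blast+
    moreover have "ind E R q = m" "outd E R q = m"
      using removable_regular[OF part S_good] q(1) by (auto simp: R_def)
    ultimately show False using q(2) by (simp add: ind_def outd_def)
  qed
  have G_sep': "\<not> E u v \<and> \<not> E v u" if "u \<in> G" "v \<in> insert x' T - G" for u v
  proof (cases "v = x'")
    case True
    then show ?thesis
      using removable_neighbour[OF part S_good, of x' u] x'R that(1) G R_G by (auto simp: R_def)
  next
    case False
    then show ?thesis using G_sep that by auto
  qed
  have F_sep': "\<not> E u v \<and> \<not> E v u"
    if "u \<in> F \<union> (A - {x'})" "v \<in> S - {x'} - (F \<union> (A - {x'}))" for u v
    using that F_sep[of u v] A_sep[of u v] by auto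
  (* There are no arcs between F and A, so a set that meets F already has a vertex of too small
     degree in its trace on F; any other set is a proper subset of A. *)
  have F_un': "unabsorbable m E (F \<union> (A - {x'})) w" if w: "w \<in> T - G" for w
    unfolding unabsorbable_def
  proof (intro allI impI)
    fix B assume B: "B \<subseteq> F \<union> (A - {x'})" "B \<noteq> {}"
    have cross: "\<not> E u v \<and> \<not> E v u" if "u \<in> F" "v \<in> A" for u v
      using F_sep[of u v] that AS disj by (auto simp: A_def)
    show "\<exists>q\<in>B. ind E (insert w B) q < m \<or> outd E (insert w B) q < m"
    proof (cases "B \<inter> F = {}")
      case True
      then have "B \<subset> A" using B x' by auto
      then show ?thesis
        using proper_subset_unabsorbable[OF ST T, of w B] B w by (auto simp: A_def)
    next
      case False
      then obtain q where q: "q \<in> B \<inter> F"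
        "ind E (insert w (B \<inter> F)) q < m \<or> outd E (insert w (B \<inter> F)) q < m"
        using F_un[OF w] unfolding unabsorbable_def by (meson Int_lower2)
      have "{u \<in> insert w (B \<inter> F). E u q} = {u \<in> insert w B. E u q}"
        "{u \<in> insert w (B \<inter> F). E q u} = {u \<in> insert w B. E q u}"
        using cross q(1) B(1) by blast+
      then show ?thesis using q by (auto simp: ind_def outd_def)
    qed
  qed
  have "frozen_state (insert x' T) (S - {x'}) G (F \<union> (A - {x'})) x'"
    unfolding frozen_state_def
  proof (intro conjI ballI)
    fix w assume "w \<in> S - {x'} - (F \<union> (A - {x'}))"
    then show "unabsorbable m E G w" using G_un[of w] x by (auto simp: A_def)
  next
    fix w assume "w \<in> insert x' T - G - {x'}"
    then show "unabsorbable m E (F \<union> (A - {x'})) w" using F_un' by auto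
  qed (use part S_good x'R R_G G_sep' F_sep' F G AS x'S in \<open>auto simp: R_def\<close>)
  moreover have "card (F \<union> G) < card (G \<union> (F \<union> (A - {x'})))"
  proof (rule psubset_card_mono)
    show "finite (G \<union> (F \<union> (A - {x'})))"
      using F G AS \<open>finite S\<close> \<open>finite T\<close> by (meson finite_Diff finite_UnI finite_subset)
    have "x \<in> A" "x \<notin> F" "x \<notin> G" using x disj AS G ST(2) by (auto simp: A_def)
    then show "F \<union> G \<subset> G \<union> (F \<union> (A - {x'}))" using x' by auto
  qed
  ultimately show ?thesis by blast
qed

lemma no_frozen_state: "\<not> frozen_state S T F G x"
proof
  assume "frozen_state S T F G x"
  then show False
  proof (induction "card V - card (F \<union> G)" arbitrary: S T F G x rule: less_induct)
    case less
    obtain S' T' F' G' x' where st: "frozen_state S' T' F' G' x'" "card (F \<union> G) < card (F' \<union> G')"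
      using frozen_state_step[OF less.prems] by blast
    then have "F' \<union> G' \<subseteq> V" by (auto simp: frozen_state_def)
    then have "card (F' \<union> G') \<le> card V" using fin card_mono by blast
    then show ?case using less.hyps[OF _ st(1)] st(2) by linarith
  qed
qed

text \<open>
  A two-colouring of the other vertices would start the process with nothing frozen.
\<close>
lemma not_colorable_minus: 
  assumes "v \<in> V"
  shows "\<not> colorable m E 2 (V - {v})"
proof
  assume "colorable m E 2 (V - {v})"
  then obtain S T where ST: "S \<union> T = V - {v}" "S \<inter> T = {}" "degenerate m E S" "degenerate m E T"
    unfolding colorable_two by blast
  have "insert v S - {v} = S" using ST(1) by auto
  then have "v \<in> removable m E (insert v S)" using ST(3) by (auto simp: removable_def)
  moreover have "insert v S \<union> T = V" "insert v S \<inter> T = {}" using ST assms by auto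
  ultimately have "frozen_state (insert v S) T {} {} v"
    unfolding frozen_state_def unabsorbable_def using ST(4) by auto
  then show False using no_frozen_state by blast
qed

end

lemma colorable_empty: "0 < k \<Longrightarrow> colorable m E k {}"
  by (auto simp: colorable_def degenerate_def)

lemma colorable_two_if_degree_le:
  assumes "finite V" and asym: "\<And>u v. E u v \<Longrightarrow> \<not> E v u" and "0 < m"
    and "\<And>v. v \<in> V \<Longrightarrow> ind E V v + outd E V v \<le> 4 * m"
  shows "colorable m E 2 V"
  using assms(1,4)
proof (induction V rule: finite_psubset_induct)
  case (psubset V)
  show ?case
  proof (cases "V = {}")
    case False
    then obtain v where v: "v \<in> V" by blast
    have "colorable m E 2 (V - {v})"
    proof (rule psubset.IH)
      show "V - {v} \<subset> V" using v by auto
      fix u assume "u \<in> V - {v}"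
      then show "ind E (V - {v}) u + outd E (V - {v}) u \<le> 4 * m"
        using psubset.prems[of u] ind_mono[OF psubset.hyps, of "V - {v}" E u]
          outd_mono[OF psubset.hyps, of "V - {v}" E u] by auto
    qed
    then show ?thesis
      using two_color_obstruction.not_colorable_minus[of E m V v] v psubset asym \<open>0 < m\<close>
      by (auto simp: two_color_obstruction_def)
  qed (simp add: colorable_empty)
qed

section \<open>Many colours\<close>

text \<open>
  The factor 2 keeps the bound integral: two colours account for \<open>4 m + 1\<close> in the total degree
  plus one, hence one colour for half of that. For \<open>k = 1\<close> the bound says, by parity, that the
  total degree is below \<open>2 m\<close>.
\<close>
lemma colorable_if_degree_le:
  assumes "finite V" and asym: "\<And>u v. E u v \<Longrightarrow> \<not> E v u" and "0 < m" "0 < k"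
    and "\<And>v. v \<in> V \<Longrightarrow> 2 * (ind E V v + outd E V v + 1) \<le> k * (4 * m + 1)"
  shows "colorable m E k V"
  using assms(1,4,5)
proof (induction k arbitrary: V rule: less_induct)
  case (less k)
  consider "k = 1" | "k = 2" | "k > 2" using less.prems(2) by linarith
  then show ?case
  proof cases
    case 1
    have "degenerate m E V"
      using less.prems(1,3) 1 by (intro degenerate_if_degree_small) fastforce+
    then show ?thesis using 1 by (auto simp: colorable_def intro!: exI[of _ "\<lambda>_. 0"])
  next
    case 2
    have "ind E V v + outd E V v \<le> 4 * m" if "v \<in> V" for v
      using less.prems(3)[OF that] 2 by simp
    then show ?thesis
      unfolding 2 using less.prems(1) asym \<open>0 < m\<close> by (intro colorable_two_if_degree_le) auto
  next
    case 3
    define c where "c = (k - 2) * (4 * m + 1)"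
    define b where "b = c div 2 - 1"
    have "1 * 2 \<le> c"
      unfolding c_def using 3 \<open>0 < m\<close> by (intro mult_le_mono) auto
    then have b: "b + 1 = c div 2" by (simp add: b_def)
    have k: "k * (4 * m + 1) = 2 * (4 * m + 1) + c"
      unfolding c_def using 3 by (metis add_mult_distrib le_add_diff_inverse less_imp_le)
    have "ind E V v + outd E V v \<le> 4 * m + b + 1" if "v \<in> V" for v
      using less.prems(3)[OF that] b unfolding k by presburger
    then obtain X Y where XY: "X \<union> Y = V" "X \<inter> Y = {}"
      and X: "\<forall>v\<in>X. ind E X v + outd E X v \<le> 4 * m" and Y: "\<forall>v\<in>Y. ind E Y v + outd E Y v \<le> b"
      using exists_split_degree_le[OF less.prems(1), of E "4 * m" b] asym by blast
    have "finite X" "finite Y" using XY less.prems(1) by auto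
    have "colorable m E 2 X"
      using X \<open>finite X\<close> asym \<open>0 < m\<close> by (intro colorable_two_if_degree_le) auto
    moreover have "colorable m E (k - 2) Y"
    proof (rule less.IH)
      fix v assume "v \<in> Y"
      then have "ind E Y v + outd E Y v + 1 \<le> c div 2" using Y b by auto
      then show "2 * (ind E Y v + outd E Y v + 1) \<le> (k - 2) * (4 * m + 1)"
        unfolding c_def[symmetric] by presburger
    qed (use 3 \<open>finite Y\<close> in auto)
    ultimately have "colorable m E (2 + (k - 2)) (X \<union> Y)" by (rule colorable_Un)
    moreover have "2 + (k - 2) = k" using 3 by linarith
    ultimately show ?thesis using XY(1) by metis
  qed
qed

text \<open>
  The vertex \<open>v\<close> cannot join any of the \<open>k\<close> disjoint classes of the colouring of \<open>V - {v}\<close>, so each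
  of them contributes \<open>m\<close> to its in-degree and to its out-degree.
\<close>
lemma critical_degrees:
  assumes "finite V" and noloop: "\<not> E v v" and "v \<in> V"
    and "colorable m E k (V - {v})" "\<not> colorable m E k V"
  shows "k * m \<le> ind E V v" "k * m \<le> outd E V v"
proof -
  obtain f where f: "\<forall>u\<in>V - {v}. f u < k" "\<forall>i<k. degenerate m E {u \<in> V - {v}. f u = i}"
    using assms(4) unfolding colorable_def by blast
  define S where "S i = {u \<in> V - {v}. f u = i}" for i
  have fin: "finite (S i)" for i using assms(1) by (simp add: S_def)
  have "\<not> degenerate m E (insert v (S i))" if "i < k" for i
  proof
    assume good: "degenerate m E (insert v (S i))"
    have "degenerate m E {u \<in> V. (f(v := i)) u = j}" if "j < k" for j
    proof (cases "j = i")
      case True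
      then show ?thesis by (intro degenerate_subset[OF good]) (auto simp: S_def)
    next
      case False
      then have "{u \<in> V. (f(v := i)) u = j} \<subseteq> S j" by (auto simp: S_def)
      moreover have "degenerate m E (S j)" using f(2) that by (simp add: S_def)
      ultimately show ?thesis by (metis degenerate_subset)
    qed
    then have "colorable m E k V"
      unfolding colorable_def using f(1) that by (intro exI[of _ "f(v := i)"]) auto
    with assms(5) show False by blast
  qed
  then have large: "m \<le> ind E (S i) v" "m \<le> outd E (S i) v" if "i < k" for i
    using that degenerate_insert[OF fin, of m E i v] f(2) noloop
    by (force simp: S_def not_less[symmetric])+
  have "k * m = (\<Sum>i<k. m)" by simp
  also have "\<dots> \<le> (\<Sum>i<k. card {u \<in> S i. E u v})"
    using large(1) by (intro sum_mono) (auto simp: ind_def)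
  also have "\<dots> = card (\<Union>i<k. {u \<in> S i. E u v})"
    using assms(1) by (subst card_UN_disjoint) (auto simp: S_def)
  also have "\<dots> \<le> ind E V v"
    unfolding ind_def using assms(1) by (intro card_mono) (auto simp: S_def)
  finally show "k * m \<le> ind E V v" .
  have "k * m = (\<Sum>i<k. m)" by simp
  also have "\<dots> \<le> (\<Sum>i<k. card {u \<in> S i. E v u})"
    using large(2) by (intro sum_mono) (auto simp: outd_def)
  also have "\<dots> = card (\<Union>i<k. {u \<in> S i. E v u})"
    using assms(1) by (subst card_UN_disjoint) (auto simp: S_def)
  also have "\<dots> \<le> outd E V v"
    unfolding outd_def using assms(1) by (intro card_mono) (auto simp: S_def)
  finally show "k * m \<le> outd E V v" .
qed

text \<open>
  In a minimal uncolourable subset all degrees are at least \<open>k m\<close> by \<open>critical_degrees\<close>. The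
  condition speaks of all \<open>p\<close> and \<open>q\<close> below the two degrees so that it is inherited by subsets
  of \<open>V\<close>, where the degrees may be smaller.
\<close>
lemma colorable_if_critical_degree_le:
  assumes "finite V" and asym: "\<And>u v. E u v \<Longrightarrow> \<not> E v u" and "0 < m" "0 < k"
    and "\<And>v p q. v \<in> V \<Longrightarrow> p \<le> ind E V v \<Longrightarrow> q \<le> outd E V v \<Longrightarrow> k * m \<le> p \<Longrightarrow> k * m \<le> q \<Longrightarrow>
      2 * (p + q + 1) \<le> k * (4 * m + 1)"
  shows "colorable m E k V"
  using assms(1,5)
proof (induction V rule: finite_psubset_induct)
  case (psubset V)
  show ?case
  proof (rule ccontr)
    assume not: "\<not> colorable m E k V"
    have "2 * (ind E V v + outd E V v + 1) \<le> k * (4 * m + 1)" if v: "v \<in> V" for v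
    proof (rule psubset.prems[OF v order.refl order.refl])
      have "colorable m E k (V - {v})"
      proof (rule psubset.IH)
        show "V - {v} \<subset> V" using v by auto
        fix u p q assume "u \<in> V - {v}" and le: "p \<le> ind E (V - {v}) u" "q \<le> outd E (V - {v}) u"
          and "k * m \<le> p" "k * m \<le> q"
        moreover have "p \<le> ind E V u" "q \<le> outd E V u"
          using le ind_mono[OF psubset.hyps, of "V - {v}" E u]
            outd_mono[OF psubset.hyps, of "V - {v}" E u] by auto
        ultimately show "2 * (p + q + 1) \<le> k * (4 * m + 1)" using psubset.prems[of u p q] by auto
      qed
      then show "k * m \<le> ind E V v" "k * m \<le> outd E V v"
        using critical_degrees[OF psubset.hyps _ v _ not] asym by blast+
    qed
    then have "colorable m E k V"
      using psubset.hyps asym \<open>0 < m\<close> \<open>0 < k\<close> by (intro colorable_if_degree_le) auto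
    with not show False by blast
  qed
qed

section \<open>From the geometric mean to the total degree\<close>

text \<open>
  Write \<open>N = 4 m + 1\<close>. From \<open>(p - k m) (q - k m) \<ge> 0\<close> follows \<open>k m (p + q) \<le> p q + (k m)\<^sup>2\<close>,
  and the lower bound on \<open>k\<close> says that \<open>2 p q N\<^sup>2 < (k N - 2)\<^sup>2 m (2 m + 1)\<close>. If the claim failed,
  then \<open>2 (p + q) \<ge> k N - 1\<close> by integrality, and the three inequalities combine to
  \<open>k (N\<^sup>2 + 2 N) < 2 N + 2\<close>, which is absurd.
\<close>
lemma degree_sum_bound:
  fixes m k p q :: nat and \<Delta> :: real
  assumes m: "0 < m"
    and \<Delta>: "sqrt (real q * real p) \<le> \<Delta>"
    and k: "sqrt (2 * real m / (2 * real m + 1)) * (\<Delta> / real m) + 2 / (4 * real m + 1) < real k"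
    and pq: "k * m \<le> p" "k * m \<le> q"
  shows "2 * (p + q + 1) \<le> k * (4 * m + 1)"
proof (rule ccontr)
  define M K P Q N where "M = real m" and "K = real k" and "P = real p" and "Q = real q"
    and "N = 4 * M + 1"
  assume "\<not> ?thesis"
  then have "k * (4 * m + 1) + 1 \<le> 2 * (p + q + 1)" by simp
  then have "real (k * (4 * m + 1) + 1) \<le> real (2 * (p + q + 1))" by (rule of_nat_mono)
  then have sum: "K * N - 1 \<le> 2 * (P + Q)"
    by (simp add: K_def N_def M_def P_def Q_def algebra_simps)
  have M: "1 \<le> M" using m by (simp add: M_def)
  have "0 \<le> sqrt (real q * real p)" by simp
  then have "0 \<le> \<Delta>" using \<Delta> by linarith
  have "0 \<le> sqrt (2 * M / (2 * M + 1)) * (\<Delta> / M)" using M \<open>0 \<le> \<Delta>\<close> by simp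
  moreover have "sqrt (2 * M / (2 * M + 1)) * (\<Delta> / M) < K - 2 / N"
    using k by (simp add: M_def K_def N_def)
  ultimately have "(sqrt (2 * M / (2 * M + 1)) * (\<Delta> / M))\<^sup>2 < (K - 2 / N)\<^sup>2"
    by (intro power_strict_mono) auto
  then have "2 * M / (2 * M + 1) * (\<Delta>\<^sup>2 / M\<^sup>2) < (K - 2 / N)\<^sup>2"
    using M by (simp add: power_mult_distrib power_divide)
  moreover have "Q * P \<le> \<Delta>\<^sup>2"
    using \<Delta> by (metis P_def Q_def real_sqrt_le_iff real_sqrt_abs abs_of_nonneg \<open>0 \<le> \<Delta>\<close>)
  then have "2 * M / (2 * M + 1) * (Q * P / M\<^sup>2) \<le> 2 * M / (2 * M + 1) * (\<Delta>\<^sup>2 / M\<^sup>2)"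
    using M by (intro mult_left_mono divide_right_mono) auto
  ultimately have "2 * M / (2 * M + 1) * (Q * P / M\<^sup>2) < (K - 2 / N)\<^sup>2" by linarith
  moreover have "2 * M / (2 * M + 1) * (Q * P / M\<^sup>2) = 2 * (Q * P) / (M * (2 * M + 1))"
    using M by (simp add: field_simps power2_eq_square)
  moreover have "K - 2 / N = (K * N - 2) / N" using M by (simp add: field_simps N_def)
  ultimately have "2 * (Q * P) / (M * (2 * M + 1)) < (K * N - 2)\<^sup>2 / N\<^sup>2"
    by (simp add: power_divide)
  moreover have "0 < M * (2 * M + 1)" "0 < N\<^sup>2" using M by (auto simp: N_def)
  ultimately have "2 * (Q * P) * N\<^sup>2 < (K * N - 2)\<^sup>2 * (M * (2 * M + 1))"
    by (simp only: pos_divide_less_eq pos_less_divide_eq times_divide_eq_left)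
  moreover have "K * M \<le> P" "K * M \<le> Q"
    using pq by (simp_all add: K_def M_def P_def Q_def flip: of_nat_mult)
  then have "0 \<le> (P - K * M) * (Q - K * M)" by simp
  then have "K * M * (2 * (P + Q)) \<le> 2 * (Q * P) + 2 * (K * M)\<^sup>2"
    by (simp add: algebra_simps power2_eq_square)
  moreover have "K * M * (K * N - 1) \<le> K * M * (2 * (P + Q))"
    using sum M by (intro mult_left_mono) (auto simp: K_def)
  ultimately have low: "K * M * (K * N - 1) - 2 * (K * M)\<^sup>2 \<le> 2 * (Q * P)"
    and up: "2 * (Q * P) * N\<^sup>2 < (K * N - 2)\<^sup>2 * (M * (2 * M + 1))" by linarith+
  have "(K * M * (K * N - 1) - 2 * (K * M)\<^sup>2) * N\<^sup>2 < (K * N - 2)\<^sup>2 * (M * (2 * M + 1))"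
    using mult_right_mono[OF low, of "N\<^sup>2"] up by simp
  then have "M * ((K * (K * N - 1) - 2 * K\<^sup>2 * M) * N\<^sup>2) < M * ((K * N - 2)\<^sup>2 * (2 * M + 1))"
    by (simp add: algebra_simps power2_eq_square)
  then have "(K * (K * N - 1) - 2 * K\<^sup>2 * M) * N\<^sup>2 < (K * N - 2)\<^sup>2 * (2 * M + 1)"
    using M by simp
  moreover have "(K * N - 2)\<^sup>2 * (2 * M + 1) - (K * (K * N - 1) - 2 * K\<^sup>2 * M) * N\<^sup>2 =
      2 * N + 2 - K * (N\<^sup>2 + 2 * N)"
    by (simp add: N_def algebra_simps power2_eq_square)
  ultimately have "K * (N\<^sup>2 + 2 * N) < 2 * N + 2" by linarith
  moreover have "1 \<le> K"
  proof -
    have "0 < K" using \<open>0 \<le> sqrt (2 * M / (2 * M + 1)) * (\<Delta> / M)\<close>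
      \<open>sqrt (2 * M / (2 * M + 1)) * (\<Delta> / M) < K - 2 / N\<close> M
      by (smt (verit) N_def divide_pos_pos)
    then show ?thesis by (simp add: K_def)
  qed
  then have "1 * (N\<^sup>2 + 2 * N) \<le> K * (N\<^sup>2 + 2 * N)"
    using M by (intro mult_right_mono) (auto simp: N_def)
  moreover have "5 * 5 \<le> N * N" using M by (intro mult_mono) (auto simp: N_def)
  ultimately show False by (simp add: power2_eq_square)
qed

section \<open>Digraphs\<close>

text \<open>
  Without parallel arcs, the arcs at a vertex correspond to its neighbours.
\<close>
lemma (in digraph) induced_degrees:
  assumes H: "arcs H = {e \<in> arcs G. tail G e \<in> verts H \<and> head G e \<in> verts H}"
    "tail H = tail G" "head H = head G" and v: "v \<in> verts H"
  shows "in_degree H v = ind (\<lambda>u w. (u, w) \<in> arcs_ends G) (verts H) v"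
    "out_degree H v = outd (\<lambda>u w. (u, w) \<in> arcs_ends G) (verts H) v"
proof -
  have "inj_on (tail G) (in_arcs H v)" "inj_on (head G) (out_arcs H v)"
    using no_multi_arcs H
    by (auto simp: inj_on_def in_arcs_def out_arcs_def arc_to_ends_def)
  moreover have "tail G ` in_arcs H v = {u \<in> verts H. (u, v) \<in> arcs_ends G}"
    "head G ` out_arcs H v = {u \<in> verts H. (v, u) \<in> arcs_ends G}"
    using H v by (auto simp: in_arcs_def out_arcs_def arcs_ends_def arc_to_ends_def image_iff)
  ultimately show "in_degree H v = ind (\<lambda>u w. (u, w) \<in> arcs_ends G) (verts H) v"
    "out_degree H v = outd (\<lambda>u w. (u, w) \<in> arcs_ends G) (verts H) v"
    unfolding in_degree_def out_degree_def ind_def outd_def by (metis card_image)+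
qed

lemma (in digraph) weakly_degenerate_if_degenerate:
  assumes S: "S \<subseteq> verts G" and good: "degenerate m (\<lambda>u w. (u, w) \<in> arcs_ends G) S"
  shows "weakly_degenerate m (G \<restriction> S)"
  unfolding weakly_degenerate_def
proof (intro allI impI, elim conjE)
  fix H assume H: "induced_subgraph H (G \<restriction> S)" and ne: "verts H \<noteq> {}"
  have sub: "verts H \<subseteq> S"
    using H by (auto simp: induced_subgraph_def subgraph_def)
  have ends: "tail H = tail G" "head H = head G"
    using H by (auto simp: induced_subgraph_def subgraph_def compatible_def induce_subgraph_def)
  have "arcs H = {e \<in> arcs G. tail G e \<in> verts H \<and> head G e \<in> verts H}"
    using H sub by (auto simp: induced_subgraph_def induce_subgraph_def)
  note deg = induced_degrees[OF this ends]
  obtain v where "v \<in> verts H" "ind (\<lambda>u w. (u, w) \<in> arcs_ends G) (verts H) v < m \<or>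
      outd (\<lambda>u w. (u, w) \<in> arcs_ends G) (verts H) v < m"
    using good sub ne unfolding degenerate_def dense_def by (meson not_less)
  then show "\<exists>v\<in>verts H. in_degree H v < m \<or> out_degree H v < m"
    using deg by (intro bexI[of _ v]) auto
qed

text \<open>
  The nonempty classes of a colouring form a partition into at most \<open>k\<close> parts.
\<close>
lemma (in oriented_graph) degenerate_chromatic_number_le:
  assumes "colorable m (\<lambda>u w. (u, w) \<in> arcs_ends G) k (verts G)"
  shows "degenerate_chromatic_number m G \<le> k"
proof -
  let ?E = "\<lambda>u w. (u, w) \<in> arcs_ends G"
  obtain f :: "'a \<Rightarrow> nat" where f: "\<forall>v\<in>verts G. f v < k"
    "\<forall>i<k. degenerate m ?E {v \<in> verts G. f v = i}"
    using assms unfolding colorable_def by blast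
  define P where "P = (\<lambda>i. {v \<in> verts G. f v = i}) ` f ` verts G"
  have "weakly_degenerate m (G \<restriction> S)" if "S \<in> P" for S
    using that f by (intro weakly_degenerate_if_degenerate) (auto simp: P_def)
  moreover have "partition_on (verts G) P"
    by (auto simp: partition_on_def P_def disjoint_def)
  ultimately have P: "degenerate_partition m G P" by (simp add: degenerate_partition_def)
  have "card P \<le> card (f ` verts G)" unfolding P_def by (rule card_image_le) simp
  also have "\<dots> \<le> card {..<k}" using f(1) by (intro card_mono) auto
  finally have "card P \<le> k" by simp
  moreover have "0 < card P" using verts_nonempty by (auto simp: P_def card_gt_0_iff)
  then have "degenerate_chromatic_number m G \<le> card P"
    unfolding degenerate_chromatic_number_def using P by (intro Least_le) auto
  ultimately show ?thesis by linarith
qed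

theorem theorem2p10:
  fixes D :: "('a, 'b) pre_digraph" and m :: nat
  assumes "0 < m" and "oriented_graph D"
  shows "int (degenerate_chromatic_number m D) \<le>
    \<lfloor>sqrt (2 * real m / (2 * real m + 1)) * (max_geo_degree D / real m)
      + 2 / (4 * real m + 1)\<rfloor> + 1"
proof -
  interpret oriented_graph D by (rule assms(2))
  let ?E = "\<lambda>u w. (u, w) \<in> arcs_ends D"
  define x where "x = sqrt (2 * real m / (2 * real m + 1)) * (max_geo_degree D / real m)
      + 2 / (4 * real m + 1)"
  define k where "k = nat (\<lfloor>x\<rfloor> + 1)"
  have asym: "\<not> ?E v u" if uv: "?E u v" for u v
  proof
    assume "?E v u"
    then obtain e e' where e: "e \<in> arcs D" "tail D e = u" "head D e = v"
      and e': "e' \<in> arcs D" "tail D e' = v" "head D e' = u"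
      using uv by (auto simp: arcs_ends_def arc_to_ends_def)
    then have "e = e'" by (intro at_most_one_arc) auto
    then show False using e e' no_loops[of e] by auto
  qed
  have geo: "sqrt (real (outd ?E (verts D) v) * real (ind ?E (verts D) v)) \<le> max_geo_degree D"
    if v: "v \<in> verts D" for v
  proof -
    have "arcs D = {e \<in> arcs D. tail D e \<in> verts D \<and> head D e \<in> verts D}" by auto
    note deg = induced_degrees[OF this refl refl v]
    show ?thesis unfolding max_geo_degree_def deg[symmetric] using v by (intro Max_ge) auto
  qed
  obtain v where "v \<in> verts D" using verts_nonempty by blast
  have "0 \<le> sqrt (real (outd ?E (verts D) v) * real (ind ?E (verts D) v))" by simp
  then have "0 \<le> max_geo_degree D" using geo[OF \<open>v \<in> verts D\<close>] by linarith
  then have "0 \<le> x" by (simp add: x_def)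
  then have k: "int k = \<lfloor>x\<rfloor> + 1" "0 < k" by (simp_all add: k_def)
  have "x < real_of_int (\<lfloor>x\<rfloor> + 1)" by linarith
  then have xk: "x < real k" using k(1) by (metis of_int_of_nat_eq)
  have "colorable m ?E k (verts D)"
  proof (rule colorable_if_critical_degree_le[OF _ _ assms(1) k(2)])
    fix v p q
    assume v: "v \<in> verts D" and le: "p \<le> ind ?E (verts D) v" "q \<le> outd ?E (verts D) v"
      and "k * m \<le> p" "k * m \<le> q"
    moreover have "real q * real p \<le> real (outd ?E (verts D) v) * real (ind ?E (verts D) v)"
      using le by (intro mult_mono) auto
    then have "sqrt (real q * real p) \<le> max_geo_degree D"
      using geo[OF v] by (meson order.trans real_sqrt_le_mono)
    ultimately show "2 * (p + q + 1) \<le> k * (4 * m + 1)"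
      using xk unfolding x_def by (intro degree_sum_bound[OF assms(1)]) auto
  qed (use asym in auto)
  then have "degenerate_chromatic_number m D \<le> k" by (rule degenerate_chromatic_number_le)
  then show ?thesis using k(1) unfolding x_def by linarith
qed

end
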